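(* Fix any $\gamma>0$ and consider the non-strongly convex quadratic optimization problem $\min_{x\in\mathbb{R}^d} f(x)$, $f(x)=\frac1n\sum_{i=1}^n f_i(x)$, where $f_i(x)=\frac12 x^\top A_i x-b_i^\top x$ for all $i\in\{1,\dots,n\}$, with $A_i\in\mathbb{R}^{d\times d}$ symmetric positive semidefinite and $b_i\in\mathbb{R}^d$. Assume that there exists $x_*\in\mathbb{R}^d$ such that $\nabla f_i(x_* )=0$ for all $i$ (interpolation), and consider two adaptive extrapolation strategies: 1. (FedExProx-GraDS) Set $$\alpha_k=\frac{\frac1n\sum_{i=1}^n\|\nabla M^\gamma_{f_i}(x_k)\|^2}{\left\|\frac1n\sum_{i=1}^n\nabla M^\gamma_{f_i}(x_k)\right\|^2}\ \ge\ 1.$$ Then the iterates of FedExProx satisfy $$\|x_K-\Pi(x_K)\|^2\le(1-C_G)^K\|x_0-\Pi(x_0)\|^2,\qquad C_G:=\min_{k=0,\dots,K-1}\alpha_k\,\gamma\,\frac{2+\gamma L_{\max}}{1+\gamma L_{\max}}\,\mu_\gamma^+ .$$ 2. (FedExProx-StoPS) Set $$\alpha_k=\frac{\frac1n\sum_{i=1}^n\big(M^\gamma_{f_i}(x_k)-\inf M^\gamma_{f_i}\big)}{\gamma\left\|\frac1n\sum_{i=1}^n\nabla M^\gamma_{f_i}(x_k)\right\|^2}\ \ge\ \frac{1}{2\gamma L_\gamma}.$$ Then the iterates of FedExProx satisfy $$\|x_K-\Pi(x_K)\|^2\le(1-C_S)^K\|x_0-\Pi(x_0)\|^2,\qquad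 C_S:=\frac32\min_{k=0,\dots,K-1}\alpha_k\,\gamma\,\mu_\gamma^+ .$$
   Context: For a convex function $g$ and $\gamma>0$, $\mathrm{prox}_{\gamma g}(x)=\arg\min_z\{g(z)+\frac1{2\gamma}\|z-x\|^2\}$ and $M_g^\gamma(x)=\min_z\{g(z)+\frac1{2\gamma}\|z-x\|^2\}$ (Moreau envelope), with $\nabla M_g^\gamma(x)=\frac1\gamma(x-\mathrm{prox}_{\gamma g}(x))$. $M^\gamma=\frac1n\sum_{i=1}^nM^\gamma_{f_i}$ has constant Hessian $\nabla^2M^\gamma=\frac1n\sum_{i=1}^n\frac1\gamma\big(I-(\gamma A_i+I)^{-1}\big)$; $L_\gamma$ is the smoothness constant of $M^\gamma$ (the largest eigenvalue of this Hessian) and $\mu_\gamma^+$ is its smallest non-zero eigenvalue. $L_{\max}=\max_i\lambda_{\max}(A_i)$. FedExProx iterates $x_{k+1}=x_k+\alpha_k\big(\frac1n\sum_{i=1}^n\mathrm{prox}_{\gamma f_i}(x_k)-x_k\big)$ from a starting point $x_0\in\mathbb{R}^d$. $\Pi$ is the projection onto the solution set $\mathcal{X}_*=\{x:\nabla f_i(x)=0\text{ for all }i\}$. *)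

theory Defs
  imports "HOL-Analysis.Analysis"
begin

section \<open>Matrices and eigenvalues\<close>

definition psd :: "real^'d^'d \<Rightarrow> bool" where
  "psd A \<longleftrightarrow> transpose A = A \<and> (\<forall>v. 0 \<le> v \<bullet> (A *v v))"

definition eigenvalues :: "real^'d^'d \<Rightarrow> real set" where
  "eigenvalues A = {l. \<exists>v. v \<noteq> 0 \<and> A *v v = l *\<^sub>R v}"

definition lambda_max :: "real^'d^'d \<Rightarrow> real" where
  "lambda_max A = Max (eigenvalues A)"

(* Unspecified for matrices without a nonzero eigenvalue. *)
definition lambda_min_pos :: "real^'d^'d \<Rightarrow> real" where
  "lambda_min_pos A = Min (eigenvalues A - {0})"

definition quadratic :: "real^'d^'d \<Rightarrow> real^'d \<Rightarrow> real^'d \<Rightarrow> real" where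
  "quadratic A b x = (1/2) * (x \<bullet> (A *v x)) - b \<bullet> x"

section \<open>Gradients, proximal operator, Moreau envelope\<close>

definition grad :: "('a::real_inner \<Rightarrow> real) \<Rightarrow> 'a \<Rightarrow> 'a" where
  "grad g x = (THE D. GDERIV g x :> D)"

definition prox :: "real \<Rightarrow> ('a::real_inner \<Rightarrow> real) \<Rightarrow> 'a \<Rightarrow> 'a" where
  "prox \<gamma> g x = (ARG_MIN (\<lambda>z. g z + 1 / (2 * \<gamma>) * (norm (z - x))\<^sup>2) z. True)"

definition moreau :: "real \<Rightarrow> ('a::real_inner \<Rightarrow> real) \<Rightarrow> 'a \<Rightarrow> real" where
  "moreau \<gamma> g x = (INF z. g z + 1 / (2 * \<gamma>) * (norm (z - x))\<^sup>2)"

section \<open>The method\<close>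

text \<open>The functions are indexed by 1..n.\<close>

definition solution_set :: "nat \<Rightarrow> (nat \<Rightarrow> 'a::real_inner \<Rightarrow> real) \<Rightarrow> 'a set" where
  "solution_set n f = {x. \<forall>i\<in>{1..n}. grad (f i) x = 0}"

definition avg_moreau :: "real \<Rightarrow> nat \<Rightarrow> (nat \<Rightarrow> 'a::real_inner \<Rightarrow> real) \<Rightarrow> 'a \<Rightarrow> real" where
  "avg_moreau \<gamma> n f x = (1 / real n) * (\<Sum>i=1..n. moreau \<gamma> (f i) x)"

definition avg_grad_moreau :: "real \<Rightarrow> nat \<Rightarrow> (nat \<Rightarrow> 'a::real_inner \<Rightarrow> real) \<Rightarrow> 'a \<Rightarrow> 'a" where
  "avg_grad_moreau \<gamma> n f x = (1 / real n) *\<^sub>R (\<Sum>i=1..n. grad (moreau \<gamma> (f i)) x)"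

definition fedexprox ::
  "real \<Rightarrow> nat \<Rightarrow> (nat \<Rightarrow> 'a::real_inner \<Rightarrow> real) \<Rightarrow> (nat \<Rightarrow> real) \<Rightarrow> (nat \<Rightarrow> 'a) \<Rightarrow> bool" where
  "fedexprox \<gamma> n f \<alpha> x \<longleftrightarrow>
     (\<forall>k. x (Suc k) = x k + \<alpha> k *\<^sub>R ((1 / real n) *\<^sub>R (\<Sum>i=1..n. prox \<gamma> (f i) (x k)) - x k))"

text \<open>
  Both adaptive stepsizes divide by the squared norm of the averaged gradient. Under interpolation
  this vanishes exactly when the current iterate is a solution, hence a fixed point of the iteration.
  The quotient is then undefined in the mathematics, so nothing is required of
  the stepsize there: it is an arbitrary real number.
\<close>

definition grads_stepsizes ::
  "real \<Rightarrow> nat \<Rightarrow> (nat \<Rightarrow> 'a::real_inner \<Rightarrow> real) \<Rightarrow> (nat \<Rightarrow> real) \<Rightarrow> (nat \<Rightarrow> 'a) \<Rightarrow> bool" where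
  "grads_stepsizes \<gamma> n f \<alpha> x \<longleftrightarrow>
     (\<forall>k. avg_grad_moreau \<gamma> n f (x k) \<noteq> 0 \<longrightarrow>
        \<alpha> k = ((1 / real n) * (\<Sum>i=1..n. (norm (grad (moreau \<gamma> (f i)) (x k)))\<^sup>2))
              / (norm (avg_grad_moreau \<gamma> n f (x k)))\<^sup>2)"

definition stops_stepsizes ::
  "real \<Rightarrow> nat \<Rightarrow> (nat \<Rightarrow> 'a::real_inner \<Rightarrow> real) \<Rightarrow> (nat \<Rightarrow> real) \<Rightarrow> (nat \<Rightarrow> 'a) \<Rightarrow> bool" where
  "stops_stepsizes \<gamma> n f \<alpha> x \<longleftrightarrow>
     (\<forall>k. avg_grad_moreau \<gamma> n f (x k) \<noteq> 0 \<longrightarrow>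
        \<alpha> k = ((1 / real n) * (\<Sum>i=1..n. moreau \<gamma> (f i) (x k) - (INF y. moreau \<gamma> (f i) y)))
              / (\<gamma> * (norm (avg_grad_moreau \<gamma> n f (x k)))\<^sup>2))"

section \<open>Constants\<close>

text \<open>
  The constant Hessian of the averaged Moreau envelope of the quadratics; that it is the
  derivative of the gradient is \<open>hessian_avg_moreau\<close> below.
\<close>

definition moreau_hessian :: "real \<Rightarrow> nat \<Rightarrow> (nat \<Rightarrow> real^'d^'d) \<Rightarrow> real^'d^'d" where
  "moreau_hessian \<gamma> n A =
     (1 / real n) *\<^sub>R (\<Sum>i=1..n. (1 / \<gamma>) *\<^sub>R (mat 1 - matrix_inv (\<gamma> *\<^sub>R A i + mat 1)))"

definition L_gamma :: "real \<Rightarrow> nat \<Rightarrow> (nat \<Rightarrow> real^'d^'d) \<Rightarrow> real" where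
  "L_gamma \<gamma> n A = lambda_max (moreau_hessian \<gamma> n A)"

definition mu_gamma_pos :: "real \<Rightarrow> nat \<Rightarrow> (nat \<Rightarrow> real^'d^'d) \<Rightarrow> real" where
  "mu_gamma_pos \<gamma> n A = lambda_min_pos (moreau_hessian \<gamma> n A)"

definition L_max :: "nat \<Rightarrow> (nat \<Rightarrow> real^'d^'d) \<Rightarrow> real" where
  "L_max n A = (MAX i\<in>{1..n}. lambda_max (A i))"

section \<open>Consistency of the definitions on quadratics\<close>

lemma grad_eqI:
  assumes "GDERIV g x :> D" shows "grad g x = D"
  unfolding grad_def
proof (rule the_equality)
  fix E assume "GDERIV g x :> E"
  then have "(\<lambda>h. h \<bullet> E) = (\<lambda>h. h \<bullet> D)"
    using assms unfolding gderiv_def by (rule has_derivative_unique)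
  then have "(E - D) \<bullet> (E - D) = 0"
    by (simp add: fun_eq_iff inner_diff_right)
  then show "E = D" by simp
qed (rule assms)

lemma psd_inner:
  assumes "psd A" shows "u \<bullet> (A *v v) = (A *v u) \<bullet> v"
  using assms unfolding psd_def by (metis dot_lmul_matrix transpose_matrix_vector)

lemma gderiv_quadratic:
  assumes "psd A" shows "GDERIV (quadratic A b) x :> A *v x - b"
proof -
  have "(quadratic A b has_derivative
      (\<lambda>h. (1/2) * (x \<bullet> (A *v h) + h \<bullet> (A *v x)) - b \<bullet> h)) (at x)"
    unfolding quadratic_def
    by (auto intro!: derivative_eq_intros
        bounded_linear.has_derivative[OF matrix_vector_mul_bounded_linear])
  moreover have "(\<lambda>h. (1/2) * (x \<bullet> (A *v h) + h \<bullet> (A *v x)) - b \<bullet> h) = (\<lambda>h. h \<bullet> (A *v x - b))"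
  proof
    fix h
    have "x \<bullet> (A *v h) = h \<bullet> (A *v x)" using psd_inner[OF assms, of x h] by (simp add: inner_commute)
    then show "(1/2) * (x \<bullet> (A *v h) + h \<bullet> (A *v x)) - b \<bullet> h = h \<bullet> (A *v x - b)"
      by (simp add: inner_diff_right inner_commute[of b])
  qed
  ultimately show ?thesis unfolding gderiv_def by simp
qed

lemma resolvent:
  fixes A :: "real^'d^'d"
  assumes "psd A" "\<gamma> > 0"
  shows "\<gamma> *\<^sub>R (A *v (matrix_inv (\<gamma> *\<^sub>R A + mat 1) *v y)) + matrix_inv (\<gamma> *\<^sub>R A + mat 1) *v y = y"
proof -
  let ?B = "\<gamma> *\<^sub>R A + mat 1"
  have Bv: "?B *v v = \<gamma> *\<^sub>R (A *v v) + v" for v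
    by (simp add: matrix_vector_mult_add_rdistrib scaleR_matrix_vector_assoc)
  have "v = 0" if "?B *v v = 0" for v
  proof -
    have "\<gamma> * (v \<bullet> (A *v v)) + v \<bullet> v = 0"
      using that by (metis Bv inner_add_right inner_scaleR_right inner_zero_right)
    moreover have "0 \<le> \<gamma> * (v \<bullet> (A *v v))" using assms by (simp add: psd_def)
    ultimately have "v \<bullet> v = 0" using inner_ge_zero[of v] by linarith
    then show ?thesis by simp
  qed
  then have "invertible ?B"
    unfolding invertible_left_inverse matrix_left_invertible_ker by blast
  then have "?B ** matrix_inv ?B = mat 1"
    unfolding invertible_def matrix_inv_def by (metis (mono_tags, lifting) someI_ex)
  then have "?B *v (matrix_inv ?B *v y) = y"
    by (simp add: matrix_vector_mul_assoc)
  then show ?thesis unfolding Bv .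
qed

lemma prox_objective_quadratic:
  fixes A :: "real^'d^'d"
  assumes "psd A" "\<gamma> > 0" and p: "p = matrix_inv (\<gamma> *\<^sub>R A + mat 1) *v (x + \<gamma> *\<^sub>R b)"
  shows "quadratic A b z + 1 / (2 * \<gamma>) * (norm (z - x))\<^sup>2 =
    quadratic A b p + 1 / (2 * \<gamma>) * (norm (p - x))\<^sup>2
    + 1/2 * ((z - p) \<bullet> (A *v (z - p))) + 1 / (2 * \<gamma>) * (norm (z - p))\<^sup>2"
proof -
  define h where "h = z - p"
  have z: "z = p + h" by (simp add: h_def)
  have "\<gamma> *\<^sub>R (A *v p) + p = x + \<gamma> *\<^sub>R b" unfolding p by (rule resolvent[OF assms(1,2)])
  then have x: "x = \<gamma> *\<^sub>R (A *v p) + p - \<gamma> *\<^sub>R b" by (simp add: algebra_simps)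
  have "h \<bullet> x = \<gamma> * (h \<bullet> (A *v p)) + h \<bullet> p - \<gamma> * (h \<bullet> b)"
    by (subst x) (simp add: algebra_simps)
  then have hx: "h \<bullet> (p - x) / \<gamma> = h \<bullet> b - h \<bullet> (A *v p)"
    using \<open>\<gamma> > 0\<close> by (simp add: field_simps inner_diff_right)
  have n: "(norm (p + h - x))\<^sup>2 = (norm (p - x))\<^sup>2 + 2 * (h \<bullet> (p - x)) + (norm h)\<^sup>2"
    unfolding power2_norm_eq_inner by (simp add: algebra_simps inner_commute)
  have q: "quadratic A b (p + h) = quadratic A b p + h \<bullet> (A *v p) - h \<bullet> b + 1/2 * (h \<bullet> (A *v h))"
    using psd_inner[OF \<open>psd A\<close>, of p h]
    by (simp add: quadratic_def matrix_vector_right_distrib inner_add_left inner_add_right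
        inner_commute field_simps)
  have "1 / (2 * \<gamma>) * (norm (p + h - x))\<^sup>2 =
     1 / (2 * \<gamma>) * (norm (p - x))\<^sup>2 + h \<bullet> (p - x) / \<gamma> + 1 / (2 * \<gamma>) * (norm h)\<^sup>2"
    unfolding n using \<open>\<gamma> > 0\<close> by (simp add: field_simps)
  then show ?thesis
    unfolding h_def[symmetric] unfolding z q hx by simp
qed

lemma prox_quadratic:
  fixes A :: "real^'d^'d"
  assumes "psd A" "\<gamma> > 0"
  shows "prox \<gamma> (quadratic A b) x = matrix_inv (\<gamma> *\<^sub>R A + mat 1) *v (x + \<gamma> *\<^sub>R b)" (is "_ = ?p")
  unfolding prox_def arg_min_def
proof (rule some_equality)
  have *: "quadratic A b ?p + 1 / (2 * \<gamma>) * (norm (?p - x))\<^sup>2 + 1 / (2 * \<gamma>) * (norm (z - ?p))\<^sup>2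
      \<le> quadratic A b z + 1 / (2 * \<gamma>) * (norm (z - x))\<^sup>2" for z
    using assms(1) unfolding prox_objective_quadratic[OF assms refl, of b z] psd_def by simp
  have pos: "0 \<le> 1 / (2 * \<gamma>) * (norm (z - ?p))\<^sup>2" for z
    using \<open>\<gamma> > 0\<close> by simp
  show "is_arg_min (\<lambda>z. quadratic A b z + 1 / (2 * \<gamma>) * (norm (z - x))\<^sup>2) (\<lambda>z. True) ?p"
    unfolding is_arg_min_def using * pos by (smt (verit))
  fix z assume "is_arg_min (\<lambda>z. quadratic A b z + 1 / (2 * \<gamma>) * (norm (z - x))\<^sup>2) (\<lambda>z. True) z"
  then have "1 / (2 * \<gamma>) * (norm (z - ?p))\<^sup>2 \<le> 0"
    unfolding is_arg_min_def using *[of z] by (smt (verit))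
  then have "(norm (z - ?p))\<^sup>2 \<le> 0"
    using \<open>\<gamma> > 0\<close> by (simp add: divide_le_0_iff)
  then show "z = ?p" by simp
qed

lemma moreau_quadratic:
  fixes A :: "real^'d^'d"
  assumes "psd A" "\<gamma> > 0"
  shows "moreau \<gamma> (quadratic A b) x =
    quadratic A b (prox \<gamma> (quadratic A b) x)
    + 1 / (2 * \<gamma>) * (norm (prox \<gamma> (quadratic A b) x - x))\<^sup>2"
  unfolding moreau_def
proof (rule cInf_eq_minimum)
  fix y assume "y \<in> range (\<lambda>z. quadratic A b z + 1 / (2 * \<gamma>) * (norm (z - x))\<^sup>2)"
  then obtain z where y: "y = quadratic A b z + 1 / (2 * \<gamma>) * (norm (z - x))\<^sup>2" by blast
  have "0 \<le> 1 / (2 * \<gamma>) * (norm (z - prox \<gamma> (quadratic A b) x))\<^sup>2" using \<open>\<gamma> > 0\<close> by simp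
  then show "quadratic A b (prox \<gamma> (quadratic A b) x)
      + 1 / (2 * \<gamma>) * (norm (prox \<gamma> (quadratic A b) x - x))\<^sup>2 \<le> y"
    using spec[OF conjunct2[OF assms(1)[unfolded psd_def]], of "z - prox \<gamma> (quadratic A b) x"]
      prox_objective_quadratic[OF assms prox_quadratic[OF assms], of b z x]
    unfolding y by linarith
qed blast

lemma gderiv_moreau_quadratic:
  fixes A :: "real^'d^'d"
  assumes "psd A" "\<gamma> > 0"
  shows "GDERIV (moreau \<gamma> (quadratic A b)) x :> (1 / \<gamma>) *\<^sub>R (x - prox \<gamma> (quadratic A b) x)"
proof -
  let ?R = "matrix_inv (\<gamma> *\<^sub>R A + mat 1)"
  let ?P = "\<lambda>x. ?R *v (x + \<gamma> *\<^sub>R b)"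
  have M: "moreau \<gamma> (quadratic A b) =
      (\<lambda>x. quadratic A b (?P x) + 1 / (2 * \<gamma>) * ((?P x - x) \<bullet> (?P x - x)))"
    by (rule ext) (simp only: moreau_quadratic[OF assms] prox_quadratic[OF assms] power2_norm_eq_inner)
  have dP: "(?P has_derivative (\<lambda>h. ?R *v h)) (at x)"
    by (auto intro!: derivative_eq_intros
        bounded_linear.has_derivative[OF matrix_vector_mul_bounded_linear])
  have dq: "(quadratic A b has_derivative (\<lambda>h. h \<bullet> (A *v ?P x - b))) (at (?P x))"
    using gderiv_quadratic[OF assms(1)] unfolding gderiv_def .
  have "((\<lambda>x. quadratic A b (?P x) + 1 / (2 * \<gamma>) * ((?P x - x) \<bullet> (?P x - x))) has_derivative
     (\<lambda>h. (?R *v h) \<bullet> (A *v ?P x - b)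
        + 1 / (2 * \<gamma>) * ((?P x - x) \<bullet> (?R *v h - h) + (?R *v h - h) \<bullet> (?P x - x)))) (at x)"
    by (intro has_derivative_add has_derivative_compose[OF dP dq] has_derivative_mult_right
        has_derivative_inner has_derivative_diff dP has_derivative_ident)
  moreover have "(\<lambda>h. (?R *v h) \<bullet> (A *v ?P x - b)
        + 1 / (2 * \<gamma>) * ((?P x - x) \<bullet> (?R *v h - h) + (?R *v h - h) \<bullet> (?P x - x)))
     = (\<lambda>h. h \<bullet> ((1 / \<gamma>) *\<^sub>R (x - ?P x)))"
  proof
    fix h
    have "\<gamma> *\<^sub>R (A *v ?P x) + ?P x = x + \<gamma> *\<^sub>R b" by (rule resolvent[OF assms])
    then have "x - ?P x = \<gamma> *\<^sub>R (A *v ?P x - b)" by (simp add: algebra_simps)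
    then have g: "A *v ?P x - b = (1 / \<gamma>) *\<^sub>R (x - ?P x)"
      using \<open>\<gamma> > 0\<close> by simp
    have "1 / (2 * \<gamma>) * ((?P x - x) \<bullet> (?R *v h - h) + (?R *v h - h) \<bullet> (?P x - x))
        = (1 / \<gamma>) * ((?R *v h - h) \<bullet> (?P x - x))"
      unfolding inner_commute[of "?P x - x"] using \<open>\<gamma> > 0\<close> by (simp add: field_simps)
    then show "(?R *v h) \<bullet> (A *v ?P x - b)
        + 1 / (2 * \<gamma>) * ((?P x - x) \<bullet> (?R *v h - h) + (?R *v h - h) \<bullet> (?P x - x))
       = h \<bullet> ((1 / \<gamma>) *\<^sub>R (x - ?P x))"
      unfolding g
      by (simp add: inner_diff_left minus_diff_eq[of "?P x" x, symmetric] diff_divide_distrib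
          del: minus_diff_eq)
  qed
  ultimately show ?thesis unfolding gderiv_def M prox_quadratic[OF assms] by simp
qed

lemma gderiv_avg_moreau:
  fixes A :: "nat \<Rightarrow> real^'d^'d" and b :: "nat \<Rightarrow> real^'d"
  assumes "\<And>i. i \<in> {1..n} \<Longrightarrow> psd (A i)" "\<gamma> > 0"
  defines "f \<equiv> (\<lambda>i. quadratic (A i) (b i))"
  shows "GDERIV (avg_moreau \<gamma> n f) x :> avg_grad_moreau \<gamma> n f x"
proof -
  have "GDERIV (moreau \<gamma> (f i)) x :> grad (moreau \<gamma> (f i)) x" if "i \<in> {1..n}" for i
    using gderiv_moreau_quadratic[OF assms(1)[OF that] assms(2)] grad_eqI
    unfolding f_def by metis
  then have "((\<lambda>x. (1 / real n) * (\<Sum>i=1..n. moreau \<gamma> (f i) x)) has_derivative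
      (\<lambda>h. (1 / real n) * (\<Sum>i=1..n. h \<bullet> grad (moreau \<gamma> (f i)) x))) (at x)"
    unfolding gderiv_def by (intro has_derivative_mult_right has_derivative_sum)
  then show ?thesis
    unfolding gderiv_def avg_moreau_def[abs_def] avg_grad_moreau_def
    by (simp add: inner_sum_right)
qed

lemma hessian_avg_moreau:
  fixes A :: "nat \<Rightarrow> real^'d^'d" and b :: "nat \<Rightarrow> real^'d"
  assumes "\<And>i. i \<in> {1..n} \<Longrightarrow> psd (A i)" "\<gamma> > 0"
  defines "f \<equiv> (\<lambda>i. quadratic (A i) (b i))"
  shows "(grad (avg_moreau \<gamma> n f) has_derivative (\<lambda>h. moreau_hessian \<gamma> n A *v h)) (at x)"
    and "jacobian (grad (avg_moreau \<gamma> n f)) (at x) = moreau_hessian \<gamma> n A"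
proof -
  let ?R = "\<lambda>i. matrix_inv (\<gamma> *\<^sub>R A i + mat 1)"
  have "grad (avg_moreau \<gamma> n f) =
      (\<lambda>x. (1 / real n) *\<^sub>R (\<Sum>i=1..n. (1 / \<gamma>) *\<^sub>R (x - ?R i *v (x + \<gamma> *\<^sub>R b i))))"
  proof
    fix x
    have "grad (moreau \<gamma> (f i)) x = (1 / \<gamma>) *\<^sub>R (x - ?R i *v (x + \<gamma> *\<^sub>R b i))"
      if "i \<in> {1..n}" for i
      using grad_eqI[OF gderiv_moreau_quadratic[OF assms(1)[OF that] assms(2)]]
        prox_quadratic[OF assms(1)[OF that] assms(2)] unfolding f_def by metis
    moreover have "grad (avg_moreau \<gamma> n f) x = avg_grad_moreau \<gamma> n f x"
      unfolding f_def by (rule grad_eqI[OF gderiv_avg_moreau[OF assms(1,2)]])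
    ultimately show "grad (avg_moreau \<gamma> n f) x =
      (1 / real n) *\<^sub>R (\<Sum>i=1..n. (1 / \<gamma>) *\<^sub>R (x - ?R i *v (x + \<gamma> *\<^sub>R b i)))"
      by (simp add: avg_grad_moreau_def)
  qed
  moreover have "(\<dots> has_derivative
      (\<lambda>h. (1 / real n) *\<^sub>R (\<Sum>i=1..n. (1 / \<gamma>) *\<^sub>R (h - ?R i *v h)))) (at x)"
    by (auto intro!: derivative_eq_intros
        bounded_linear.has_derivative[OF matrix_vector_mul_bounded_linear])
  moreover have "(\<Sum>i\<in>I. (1 / \<gamma>) *\<^sub>R (mat 1 - ?R i)) *v h = (\<Sum>i\<in>I. (1 / \<gamma>) *\<^sub>R (h - ?R i *v h))"
    for I h
    by (induction I rule: infinite_finite_induct)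
      (simp_all add: matrix_vector_mult_add_rdistrib scaleR_matrix_vector_assoc[symmetric]
        matrix_vector_mult_diff_rdistrib)
  then have "moreau_hessian \<gamma> n A *v h = (1 / real n) *\<^sub>R (\<Sum>i=1..n. (1 / \<gamma>) *\<^sub>R (h - ?R i *v h))" for h
    unfolding moreau_hessian_def by (simp add: scaleR_matrix_vector_assoc[symmetric])
  ultimately show *: "(grad (avg_moreau \<gamma> n f) has_derivative (\<lambda>h. moreau_hessian \<gamma> n A *v h)) (at x)"
    by simp
  show "jacobian (grad (avg_moreau \<gamma> n f)) (at x) = moreau_hessian \<gamma> n A"
    unfolding jacobian_def frechet_derivative_at[OF *, symmetric] by simp
qed

end

theory Submission
  imports Defs
begin

text \<open>
  Every solution \<open>z\<close> is a minimiser of all the Moreau envelopes, whose gradients are the linear maps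
  \<open>Y\<^sub>i (x - z)\<close> with \<open>Y\<^sub>i = A\<^sub>i (\<gamma> A\<^sub>i + I)\<^sup>-\<^sup>1\<close>. Let \<open>H\<close> be the average of the \<open>Y\<^sub>i\<close> and \<open>e = x - \<Pi> x\<close>. A step
  replaces \<open>\<parallel>e\<parallel>\<^sup>2\<close> by at most \<open>\<parallel>e\<parallel>\<^sup>2 - 2\<alpha>\<gamma> e \<bullet> H e + \<alpha>\<^sup>2\<gamma>\<^sup>2 \<parallel>H e\<parallel>\<^sup>2\<close>, and either stepsize turns the last
  term into one that is linear in \<open>\<alpha>\<close> and bounded by a multiple of \<open>e \<bullet> H e\<close>. Since \<open>e\<close> is orthogonal
  to the kernel of \<open>H\<close>, finally \<open>e \<bullet> H e \<ge> \<mu> \<parallel>e\<parallel>\<^sup>2\<close> for the smallest nonzero eigenvalue \<open>\<mu>\<close> of \<open>H\<close>.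
\<close>

section \<open>Extreme eigenvalues of symmetric matrices\<close>

lemma symmetric_inner:
  fixes B :: "real^'d^'d"
  assumes "transpose B = B"
  shows "u \<bullet> (B *v v) = (B *v u) \<bullet> v"
  using assms by (metis dot_lmul_matrix transpose_matrix_vector)

text \<open>The form of \<open>B\<close> is nonnegative on the span of \<open>u\<close> and
  \<open>v\<close>, which bounds its discriminant there. The form may be degenerate and is
  controlled on \<open>S\<close> alone; both occur when \<open>B\<close> is \<open>l I - A\<close>
  on an invariant subspace.\<close>

lemma symmetric_Cauchy_Schwarz:
  fixes B :: "real^'d^'d"
  assumes sym: "transpose B = B" and S: "subspace S"
    and nonneg: "\<And>v. v \<in> S \<Longrightarrow> 0 \<le> v \<bullet> (B *v v)"
    and u: "u \<in> S" and v: "v \<in> S"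
  shows "(u \<bullet> (B *v v))\<^sup>2 \<le> (u \<bullet> (B *v u)) * (v \<bullet> (B *v v))"
proof -
  define a where "a = u \<bullet> (B *v u)"
  define c where "c = v \<bullet> (B *v v)"
  define m where "m = u \<bullet> (B *v v)"
  have m': "v \<bullet> (B *v u) = m"
    unfolding m_def using symmetric_inner[OF sym, of v u] by (simp add: inner_commute)
  have quad: "0 \<le> s\<^sup>2 * a - 2 * s * t * m + t\<^sup>2 * c" for s t
  proof -
    have "s *\<^sub>R u - t *\<^sub>R v \<in> S"
      using S u v by (simp add: subspace_diff subspace_scale)
    then have "0 \<le> (s *\<^sub>R u - t *\<^sub>R v) \<bullet> (B *v (s *\<^sub>R u - t *\<^sub>R v))"
      by (rule nonneg)
    also have "\<dots> = s\<^sup>2 * a - 2 * s * t * m + t\<^sup>2 * c"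
      using m' unfolding a_def c_def m_def
      by (simp add: matrix_vector_mult_diff_distrib matrix_vector_mult_scaleR inner_diff_left
          inner_diff_right algebra_simps power2_eq_square)
    finally show ?thesis .
  qed
  have "c \<ge> 0" unfolding c_def by (rule nonneg[OF v])
  then consider "c > 0" | "c = 0" by linarith
  then have "m\<^sup>2 \<le> a * c"
  proof cases
    case 1
    \<comment> \<open>Up to scaling, \<open>s = c\<close> and \<open>t = m\<close> minimise the form
      along the direction of \<open>v\<close>.\<close>
    have "0 \<le> c * (a * c - m\<^sup>2)"
      using quad[of c m] by (simp add: algebra_simps power2_eq_square)
    with 1 show ?thesis by (simp add: zero_le_mult_iff)
  next
    case 2
    have "m = 0"
    proof (rule ccontr)
      assume "m \<noteq> 0"
      \<comment> \<open>With \<open>c = 0\<close> the expression is affine in \<open>t\<close>; for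
        \<open>s = 1\<close> this \<open>t\<close> makes it equal to -1.\<close>
      then show False using quad[of 1 "(a + 1) / (2 * m)"] 2 by (simp add: field_simps)
    qed
    with 2 show ?thesis by simp
  qed
  then show ?thesis by (simp add: a_def c_def m_def)
qed

text \<open>Compactness of the unit sphere of \<open>S\<close> yields a maximiser \<open>v\<close>
  with value \<open>l\<close>. The form of \<open>l I - A\<close> is then nonnegative on
  \<open>S\<close> and zero at \<open>v\<close>, and Cauchy-Schwarz forces \<open>v\<close> into the
  kernel of that matrix.\<close>

lemma symmetric_Rayleigh_maximizer:
  fixes A :: "real^'d^'d"
  assumes sym: "transpose A = A" and S: "subspace S" "S \<noteq> {0}"
    and inv: "\<And>v. v \<in> S \<Longrightarrow> A *v v \<in> S"
  obtains v l where "v \<in> S" "v \<noteq> 0" "A *v v = l *\<^sub>R v"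
    "\<And>u. u \<in> S \<Longrightarrow> u \<bullet> (A *v u) \<le> l * (norm u)\<^sup>2"
proof -
  let ?K = "S \<inter> sphere 0 1"
  have "compact ?K" using S by (simp add: closed_Int_compact closed_subspace)
  moreover obtain w where "w \<in> S" "w \<noteq> 0" using S subspace_0 by blast
  then have "(1 / norm w) *\<^sub>R w \<in> ?K" using S by (simp add: subspace_scale)
  then have "?K \<noteq> {}" by blast
  moreover have "continuous_on ?K (\<lambda>u. u \<bullet> (A *v u))"
    by (intro continuous_intros matrix_vector_mult_linear_continuous_on)
  ultimately have "\<exists>v\<in>?K. \<forall>u\<in>?K. u \<bullet> (A *v u) \<le> v \<bullet> (A *v v)"
    by (rule continuous_attains_sup)
  then obtain v where v: "v \<in> ?K" and vmax: "\<And>u. u \<in> ?K \<Longrightarrow> u \<bullet> (A *v u) \<le> v \<bullet> (A *v v)"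
    by blast
  define l where "l = v \<bullet> (A *v v)"
  have le: "u \<bullet> (A *v u) \<le> l * (norm u)\<^sup>2" if "u \<in> S" for u
  proof (cases "u = 0")
    case False
    then have "(1 / norm u) *\<^sub>R u \<in> ?K" using S that by (simp add: subspace_scale)
    from vmax[OF this] have "(u \<bullet> (A *v u)) / (norm u)\<^sup>2 \<le> l"
      unfolding l_def by (simp add: matrix_vector_mult_scaleR power2_eq_square)
    with False show ?thesis by (simp add: field_simps)
  qed simp
  define B where "B = l *\<^sub>R mat 1 - A"
  have Bv: "B *v u = l *\<^sub>R u - A *v u" for u
    by (simp add: B_def matrix_vector_mult_diff_rdistrib scaleR_matrix_vector_assoc[symmetric])
  have "transpose B = B"
    using sym by (simp add: B_def transpose_def vec_eq_iff mat_def)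
  moreover have "0 \<le> u \<bullet> (B *v u)" if "u \<in> S" for u
    using le[OF that] by (simp add: Bv inner_diff_right power2_norm_eq_inner)
  moreover have "B *v v \<in> S"
    using v S inv by (simp add: Bv subspace_diff subspace_scale)
  \<comment> \<open>Invariance of \<open>S\<close> admits \<open>B *v v\<close> itself as the test
    vector. The last factor on the right is 0, hence so is \<open>B *v v\<close>.\<close>
  ultimately have "((B *v v) \<bullet> (B *v v))\<^sup>2 \<le> ((B *v v) \<bullet> (B *v (B *v v))) * (v \<bullet> (B *v v))"
    using v S by (intro symmetric_Cauchy_Schwarz[of _ S]) auto
  moreover have "v \<bullet> v = 1" using v by (simp add: norm_eq_1)
  then have "v \<bullet> (B *v v) = 0" by (simp add: Bv inner_diff_right l_def)
  ultimately have "B *v v = 0" by simp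
  then have "A *v v = l *\<^sub>R v" by (simp add: Bv)
  then show thesis using that v le by (metis IntD1 IntD2 dist_0_norm mem_sphere norm_zero zero_neq_one)
qed

text \<open>Eigenvectors for distinct eigenvalues are orthogonal, hence independent. Finiteness is
  what lets \<open>Max\<close> and \<open>Min\<close> in \<open>lambda_max\<close> and
  \<open>lambda_min_pos\<close> act as bounds.\<close>

lemma finite_eigenvalues_symmetric:
  fixes A :: "real^'d^'d"
  assumes "transpose A = A"
  shows "finite (eigenvalues A)"
proof -
  obtain w where w: "\<And>l. l \<in> eigenvalues A \<Longrightarrow> w l \<noteq> 0 \<and> A *v w l = l *\<^sub>R w l"
  proof -
    have "\<forall>l\<in>eigenvalues A. \<exists>v. v \<noteq> 0 \<and> A *v v = l *\<^sub>R v" by (simp add: eigenvalues_def)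
    then show thesis using that by metis
  qed
  have orth: "w l \<bullet> w m = 0" if "l \<in> eigenvalues A" "m \<in> eigenvalues A" "l \<noteq> m" for l m
  proof -
    have "m * (w l \<bullet> w m) = l * (w l \<bullet> w m)"
      using symmetric_inner[OF assms, of "w l" "w m"] w that by simp
    with that show ?thesis by simp
  qed
  have inj: "inj_on w (eigenvalues A)"
    by (rule inj_onI) (metis orth w inner_eq_zero_iff)
  have "pairwise orthogonal (w ` eigenvalues A)"
    unfolding pairwise_def orthogonal_def using orth by blast
  moreover have "0 \<notin> w ` eigenvalues A" using w by (metis imageE)
  ultimately have "finite (w ` eigenvalues A)"
    by (intro independent_imp_finite pairwise_orthogonal_independent)
  with inj show ?thesis using finite_imageD by blast
qed

lemma psd_symmetric: "psd A \<Longrightarrow> transpose A = A"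
  by (simp add: psd_def)

lemma psd_nonneg: "psd A \<Longrightarrow> 0 \<le> v \<bullet> (A *v v)"
  by (simp add: psd_def)

text \<open>The maximal Rayleigh quotient over the whole space is attained at an eigenvector, so it
  is itself an eigenvalue.\<close>

lemma psd_Rayleigh_le_lambda_max:
  fixes A :: "real^'d^'d"
  assumes "psd A"
  shows "v \<bullet> (A *v v) \<le> lambda_max A * (norm v)\<^sup>2" and "0 \<le> lambda_max A"
proof -
  note sym = psd_symmetric[OF assms]
  have "UNIV \<noteq> {0 :: real^'d}"
    by (metis UNIV_I singletonD axis_eq_0_iff zero_neq_one)
  then obtain w l where w: "w \<noteq> 0" "A *v w = l *\<^sub>R w"
    and l: "\<And>u. u \<bullet> (A *v u) \<le> l * (norm u)\<^sup>2"
    using symmetric_Rayleigh_maximizer[OF sym subspace_UNIV] by (metis UNIV_I)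
  have "l \<in> eigenvalues A" using w by (auto simp: eigenvalues_def)
  then have "l \<le> lambda_max A"
    unfolding lambda_max_def using finite_eigenvalues_symmetric[OF sym] by simp
  moreover have "0 \<le> l * (norm w)\<^sup>2" using l[of w] psd_nonneg[OF assms, of w] by linarith
  then have "0 \<le> l" using w by (simp add: zero_le_mult_iff)
  ultimately show "0 \<le> lambda_max A" "v \<bullet> (A *v v) \<le> lambda_max A * (norm v)\<^sup>2"
    using l[of v] mult_right_mono[of l "lambda_max A" "(norm v)\<^sup>2"] by auto
qed

text \<open>Cauchy-Schwarz for the form of \<open>A\<close> at the pair \<open>A *v v\<close>,
  \<open>v\<close>, followed by the Rayleigh bound at \<open>A *v v\<close>, gives the claim
  multiplied by the squared norm of \<open>A *v v\<close>. A general bound \<open>L\<close> lets one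
  constant serve all the matrices.\<close>

lemma psd_cocoercive:
  fixes A :: "real^'d^'d"
  assumes "psd A" "lambda_max A \<le> L"
  shows "(norm (A *v v))\<^sup>2 \<le> L * (v \<bullet> (A *v v))"
proof (cases "A *v v = 0")
  case False
  define N where "N = (norm (A *v v))\<^sup>2"
  have "N > 0" using False by (simp add: N_def)
  have "N\<^sup>2 = ((A *v v) \<bullet> (A *v v))\<^sup>2" by (simp add: N_def power2_norm_eq_inner)
  also have "\<dots> \<le> ((A *v v) \<bullet> (A *v (A *v v))) * (v \<bullet> (A *v v))"
    using assms by (intro symmetric_Cauchy_Schwarz[of _ UNIV]) (auto simp: psd_def)
  also have "\<dots> \<le> (L * N) * (v \<bullet> (A *v v))"
    using psd_Rayleigh_le_lambda_max(1)[OF assms(1), of "A *v v"] assms(2) \<open>N > 0\<close>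
    by (intro mult_right_mono psd_nonneg[OF assms(1)])
       (smt (verit) N_def mult_right_mono)
  finally have "N * N \<le> N * (L * (v \<bullet> (A *v v)))"
    by (simp add: power2_eq_square algebra_simps)
  with \<open>N > 0\<close> have "N \<le> L * (v \<bullet> (A *v v))" by simp
  then show ?thesis by (simp add: N_def)
next
  case True
  then show ?thesis by simp
qed

lemma psd_kernel:
  fixes A :: "real^'d^'d"
  assumes "psd A" "v \<bullet> (A *v v) = 0"
  shows "A *v v = 0"
  using psd_cocoercive[OF assms(1) order_refl, of v] assms(2) by simp

text \<open>By symmetry the orthogonal complement of the kernel is invariant. A Rayleigh maximiser
  of \<open>- A\<close> on it is an eigenvector of \<open>A\<close>, and its eigenvalue is nonzero
  because it is orthogonal to the kernel.\<close>

lemma psd_Rayleigh_ge_lambda_min_pos: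
  fixes A :: "real^'d^'d"
  assumes psd: "psd A" and orth: "\<And>w. A *v w = 0 \<Longrightarrow> v \<bullet> w = 0"
  shows "lambda_min_pos A * (norm v)\<^sup>2 \<le> v \<bullet> (A *v v)"
proof (cases "v = 0")
  \<comment> \<open>For \<open>A = 0\<close> the value \<open>lambda_min_pos A\<close> is
    unspecified, but then \<open>orth\<close> forces \<open>v = 0\<close> and both sides
    vanish.\<close>
  case False
  define S where "S = {v. \<forall>w. A *v w = 0 \<longrightarrow> v \<bullet> w = 0}"
  have "v \<in> S" using orth by (simp add: S_def)
  have S: "subspace S"
    unfolding S_def by (auto simp: subspace_def inner_add_left)
  have neg: "(- A) *v u = - (A *v u)" for u
    using matrix_vector_mult_diff_rdistrib[of 0 A u] by simp
  have "transpose (- A) = - A"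
    using psd_symmetric[OF psd] by (simp add: transpose_def vec_eq_iff)
  moreover have "S \<noteq> {0}" using \<open>v \<in> S\<close> False by blast
  moreover have "(- A) *v u \<in> S" if "u \<in> S" for u
    unfolding S_def neg by (simp add: psd_inner[OF psd, symmetric] inner_commute[of "A *v _"])
  ultimately obtain w l where w: "w \<in> S" "w \<noteq> 0" "(- A) *v w = l *\<^sub>R w"
    and l: "\<And>u. u \<in> S \<Longrightarrow> u \<bullet> ((- A) *v u) \<le> l * (norm u)\<^sup>2"
    using symmetric_Rayleigh_maximizer[OF _ S] by metis
  have Aw: "A *v w = (- l) *\<^sub>R w" using w(3) unfolding neg by (metis minus_minus scaleR_minus_left)
  moreover have "l \<noteq> 0"
  proof
    assume "l = 0"
    with Aw have "A *v w = 0" by simp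
    with w(1) have "w \<bullet> w = 0" by (simp add: S_def)
    with w(2) show False by simp
  qed
  ultimately have "- l \<in> eigenvalues A - {0}" using w(2) by (auto simp: eigenvalues_def)
  then have "lambda_min_pos A \<le> - l"
    unfolding lambda_min_pos_def
    using finite_eigenvalues_symmetric[OF psd_symmetric[OF psd]] by (intro Min_le) auto
  then have "lambda_min_pos A * (norm v)\<^sup>2 \<le> - l * (norm v)\<^sup>2"
    by (rule mult_right_mono) simp
  also have "\<dots> \<le> v \<bullet> (A *v v)" using l[OF \<open>v \<in> S\<close>] by (simp add: neg)
  finally show ?thesis .
qed simp

section \<open>The Moreau envelope of a quadratic\<close>

text \<open>The Yosida approximation \<open>A (\<gamma> A + I)^-1\<close>, which is the Hessian of
  the Moreau envelope of \<open>quadratic A b\<close>. It is written as the summand of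
  \<open>moreau_hessian\<close>, so that this Hessian is visibly an average.\<close>

definition yosida :: "real \<Rightarrow> real^'d^'d \<Rightarrow> real^'d^'d" where
  "yosida \<gamma> A = (1 / \<gamma>) *\<^sub>R (mat 1 - matrix_inv (\<gamma> *\<^sub>R A + mat 1))"

lemma resolvent_eqI:
  fixes A :: "real^'d^'d"
  assumes "psd A" "\<gamma> > 0" "\<gamma> *\<^sub>R (A *v u) + u = y"
  shows "matrix_inv (\<gamma> *\<^sub>R A + mat 1) *v y = u"
proof -
  define w where "w = matrix_inv (\<gamma> *\<^sub>R A + mat 1) *v y - u"
  have "\<gamma> *\<^sub>R (A *v w) + w = 0"
    using resolvent[OF assms(1,2), of y] assms(3) unfolding w_def
    by (simp add: matrix_vector_mult_diff_distrib algebra_simps)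
  then have "\<gamma> * (w \<bullet> (A *v w)) + w \<bullet> w = 0"
    by (metis inner_add_right inner_scaleR_right inner_zero_right)
  moreover have "0 \<le> \<gamma> * (w \<bullet> (A *v w))" using assms(1,2) by (simp add: psd_def)
  ultimately have "w \<bullet> w = 0" using inner_ge_zero[of w] by linarith
  then show ?thesis by (simp add: w_def)
qed

lemma yosida_eqI:
  fixes A :: "real^'d^'d"
  assumes "psd A" "\<gamma> > 0" "\<gamma> *\<^sub>R (A *v u) + u = e"
  shows "yosida \<gamma> A *v e = A *v u"
  using resolvent_eqI[OF assms] assms(2) assms(3)[symmetric]
  by (simp add: yosida_def scaleR_matrix_vector_assoc[symmetric] matrix_vector_mult_diff_rdistrib)

text \<open>The substitution \<open>e = u + \<gamma> A u\<close> removes the matrix inverse: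
  properties of the Yosida approximation become statements about \<open>A\<close> and
  \<open>u\<close>.\<close>

lemma yosida_obtain:
  fixes A :: "real^'d^'d"
  assumes "psd A" "\<gamma> > 0"
  obtains u where "e = u + \<gamma> *\<^sub>R (A *v u)" "yosida \<gamma> A *v e = A *v u"
  using resolvent[OF assms, of e] yosida_eqI[OF assms] by (metis add.commute)

text \<open>After substituting for both arguments, either side of the symmetry equation equals the
  inner product of \<open>u\<close> and \<open>A v\<close> plus \<gamma> times that of
  \<open>A u\<close> and \<open>A v\<close>; for equal arguments this is nonnegative.\<close>

lemma psd_yosida:
  fixes A :: "real^'d^'d"
  assumes "psd A" "\<gamma> > 0"
  shows "psd (yosida \<gamma> A)"
proof -
  have "x \<bullet> (yosida \<gamma> A *v y) = (yosida \<gamma> A *v x) \<bullet> y" for x y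
  proof -
    obtain u v where "x = u + \<gamma> *\<^sub>R (A *v u)" "yosida \<gamma> A *v x = A *v u"
      "y = v + \<gamma> *\<^sub>R (A *v v)" "yosida \<gamma> A *v y = A *v v"
      using yosida_obtain[OF assms] by metis
    then show ?thesis
      using psd_inner[OF assms(1), of u v] by (simp add: inner_add_left inner_add_right)
  qed
  then have "transpose (yosida \<gamma> A) = yosida \<gamma> A"
    by (metis dot_lmul_matrix inner_commute matrix_eq transpose_matrix_vector vector_eq_ldot)
  moreover have "0 \<le> x \<bullet> (yosida \<gamma> A *v x)" for x
  proof -
    obtain u where "x = u + \<gamma> *\<^sub>R (A *v u)" "yosida \<gamma> A *v x = A *v u"
      using yosida_obtain[OF assms] by metis
    then show ?thesis
      using psd_nonneg[OF assms(1), of u] assms(2) by (simp add: inner_add_left)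
  qed
  ultimately show ?thesis by (simp add: psd_def)
qed

lemma yosida_eq_0_iff:
  fixes A :: "real^'d^'d"
  assumes "psd A" "\<gamma> > 0"
  shows "yosida \<gamma> A *v e = 0 \<longleftrightarrow> A *v e = 0"
proof
  assume "yosida \<gamma> A *v e = 0"
  then show "A *v e = 0" using yosida_obtain[OF assms, of e] by fastforce
next
  assume "A *v e = 0"
  then show "yosida \<gamma> A *v e = 0" using yosida_eqI[OF assms, of e e] by simp
qed

text \<open>An eigenvalue of \<open>A\<close> at most \<open>L\<close> becomes one of the Yosida
  approximation at most \<open>L / (1 + \<gamma> L)\<close>, and
  \<open>2 - \<gamma> L / (1 + \<gamma> L)\<close> is the constant on the left. The proof uses
  cocoercivity of \<open>A\<close> instead of a diagonalisation.\<close>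

lemma yosida_gap:
  fixes A :: "real^'d^'d"
  assumes "psd A" "\<gamma> > 0" "lambda_max A \<le> L"
  shows "(2 + \<gamma> * L) / (1 + \<gamma> * L) * (e \<bullet> (yosida \<gamma> A *v e))
    \<le> 2 * (e \<bullet> (yosida \<gamma> A *v e)) - \<gamma> * (norm (yosida \<gamma> A *v e))\<^sup>2"
proof -
  obtain u where u: "e = u + \<gamma> *\<^sub>R (A *v u)" "yosida \<gamma> A *v e = A *v u"
    using yosida_obtain[OF assms(1,2)] by metis
  define p where "p = u \<bullet> (A *v u)"
  define q where "q = (norm (A *v u))\<^sup>2"
  have e: "e \<bullet> (yosida \<gamma> A *v e) = p + \<gamma> * q"
    unfolding u(2) unfolding u(1) by (simp add: inner_add_left p_def q_def power2_norm_eq_inner)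
  have "0 \<le> L" using psd_Rayleigh_le_lambda_max(2)[OF assms(1)] assms(3) by linarith
  then have pos: "1 + \<gamma> * L > 0" using assms(2) by (simp add: add_pos_nonneg)
  have "q \<le> L * p" unfolding p_def q_def by (rule psd_cocoercive[OF assms(1,3)])
  then have "\<gamma> * q \<le> \<gamma> * (L * p)" using assms(2) by simp
  \<comment> \<open>Expanding both sides, all terms cancel except \<open>\<gamma> * q\<close> on the
    left and \<open>\<gamma> * (L * p)\<close> on the right.\<close>
  then have "(2 + \<gamma> * L) * (p + \<gamma> * q) \<le> (2 * p + \<gamma> * q) * (1 + \<gamma> * L)"
    by (simp add: algebra_simps)
  then have "(2 + \<gamma> * L) / (1 + \<gamma> * L) * (p + \<gamma> * q) \<le> 2 * p + \<gamma> * q"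
    using pos by (simp add: field_simps)
  then show ?thesis unfolding e unfolding u(2) q_def[symmetric] by simp
qed

text \<open>With \<open>x - z = u + \<gamma> A u\<close> and \<open>A *v z = b\<close>, the point
  \<open>z + u\<close> solves the resolvent equation for \<open>x\<close>, so it is the proximal
  point; gradient and value follow from it. The base point \<open>z\<close> is any solution, and
  later the projection of \<open>x\<close>.\<close>

lemma grad_moreau_quadratic:
  fixes A :: "real^'d^'d"
  assumes "psd A" "\<gamma> > 0" "A *v z = b"
  shows "grad (moreau \<gamma> (quadratic A b)) x = yosida \<gamma> A *v (x - z)"
    and "prox \<gamma> (quadratic A b) x = x - \<gamma> *\<^sub>R (yosida \<gamma> A *v (x - z))"
    and "moreau \<gamma> (quadratic A b) x = quadratic A b z + 1/2 * ((x - z) \<bullet> (yosida \<gamma> A *v (x - z)))"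
proof -
  obtain u where u: "x - z = u + \<gamma> *\<^sub>R (A *v u)" "yosida \<gamma> A *v (x - z) = A *v u"
    using yosida_obtain[OF assms(1,2)] by metis
  have x: "x = z + u + \<gamma> *\<^sub>R (A *v u)" using u(1) by (simp add: algebra_simps)
  have pu: "prox \<gamma> (quadratic A b) x = z + u"
    unfolding prox_quadratic[OF assms(1,2)]
    by (rule resolvent_eqI[OF assms(1,2)])
      (simp add: x assms(3) matrix_vector_right_distrib algebra_simps)
  show p: "prox \<gamma> (quadratic A b) x = x - \<gamma> *\<^sub>R (yosida \<gamma> A *v (x - z))"
    unfolding u(2) pu using x by simp
  show "grad (moreau \<gamma> (quadratic A b)) x = yosida \<gamma> A *v (x - z)"
    unfolding grad_eqI[OF gderiv_moreau_quadratic[OF assms(1,2)]] p using assms(2) by simp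
  have q: "quadratic A b (z + u) = quadratic A b z + 1/2 * (u \<bullet> (A *v u))"
    using psd_inner[OF assms(1), of z u]
    by (simp add: quadratic_def assms(3)[symmetric] matrix_vector_right_distrib inner_add_left
        inner_add_right inner_commute field_simps)
  have n: "z + u - x = - (\<gamma> *\<^sub>R (A *v u))" using x by simp
  show "moreau \<gamma> (quadratic A b) x = quadratic A b z + 1/2 * ((x - z) \<bullet> (yosida \<gamma> A *v (x - z)))"
    unfolding moreau_quadratic[OF assms(1,2)] pu q n u(2) unfolding u(1)
    using assms(2)
    by (simp add: dot_square_norm inner_add_left field_simps power2_eq_square)
qed

lemma moreau_gap_quadratic:
  fixes A :: "real^'d^'d"
  assumes "psd A" "\<gamma> > 0" "A *v z = b"
  shows "moreau \<gamma> (quadratic A b) x - (INF y. moreau \<gamma> (quadratic A b) y)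
    = 1/2 * ((x - z) \<bullet> (yosida \<gamma> A *v (x - z)))"
proof -
  note M = grad_moreau_quadratic(3)[OF assms]
  have "(INF y. moreau \<gamma> (quadratic A b) y) = quadratic A b z"
  proof (rule cInf_eq_minimum)
    show "quadratic A b z \<in> range (moreau \<gamma> (quadratic A b))"
      using M[of z] by (intro image_eqI[of _ _ z]) auto
  next
    fix y assume "y \<in> range (moreau \<gamma> (quadratic A b))"
    then show "quadratic A b z \<le> y"
      using psd_nonneg[OF psd_yosida[OF assms(1,2)]] by (auto simp: M)
  qed
  then show ?thesis by (simp add: M)
qed

section \<open>One step of the method\<close>

text \<open>The variational inequality of the projection, tested at the projected point plus
  \<open>w\<close> and minus \<open>w\<close>, bounds the inner product by 0 from both
  sides.\<close>

lemma closest_point_affine_orthogonal: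
  fixes S :: "'a::euclidean_space set"
  assumes "closed S" "convex S" "S \<noteq> {}" and shift: "\<And>y. y \<in> S \<Longrightarrow> y + w \<in> S \<and> y - w \<in> S"
  shows "(x - closest_point S x) \<bullet> w = 0"
proof -
  have "closest_point S x \<in> S" using assms by (simp add: closest_point_in_set)
  from shift[OF this] show ?thesis
    using closest_point_dot[OF assms(2,1), of "closest_point S x + w" x]
      closest_point_dot[OF assms(2,1), of "closest_point S x - w" x]
    by simp
qed

text \<open>
  The rate \<open>1 - C\<close> may be negative, but only when \<open>D 0\<close> vanishes or there is no step, since
  otherwise \<open>0 \<le> D 1 \<le> (1 - c 0) * D 0\<close> forces \<open>c 0 \<le> 1\<close>.
\<close>

lemma geometric_contraction:
  fixes D c :: "nat \<Rightarrow> real"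
  assumes nonneg: "\<And>k. 0 \<le> D k" and step: "\<And>k. D (Suc k) \<le> (1 - c k) * D k"
    and C: "\<And>k. k < K \<Longrightarrow> C \<le> c k"
  shows "D K \<le> (1 - C) ^ K * D 0"
proof (cases "D 0 = 0 \<or> K = 0")
  case True
  have "D k = 0" if "D 0 = 0" for k
  proof (induction k)
    case (Suc k)
    then show ?case using step[of k] nonneg[of "Suc k"] by simp
  qed (rule that)
  with True show ?thesis by auto
next
  case False
  then have "D 0 > 0" using nonneg[of 0] by simp
  moreover have "0 \<le> (1 - c 0) * D 0" using nonneg[of "Suc 0"] step[of 0] by linarith
  ultimately have "c 0 \<le> 1" by (simp add: zero_le_mult_iff)
  then have "0 \<le> 1 - C" using C[of 0] False by simp
  have "k \<le> K \<Longrightarrow> D k \<le> (1 - C) ^ k * D 0" for k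
  proof (induction k)
    case (Suc k)
    have "D (Suc k) \<le> (1 - c k) * D k" by (rule step)
    also have "\<dots> \<le> (1 - C) * D k"
      using C[of k] Suc.prems nonneg[of k] by (intro mult_right_mono) auto
    also have "\<dots> \<le> (1 - C) * ((1 - C) ^ k * D 0)"
      using Suc \<open>0 \<le> 1 - C\<close> by (intro mult_left_mono) auto
    finally show ?case by simp
  qed simp
  then show ?thesis by blast
qed

lemma norm_sum_squared_le:
  fixes v :: "'i \<Rightarrow> 'a::real_inner"
  shows "(norm (\<Sum>i\<in>I. v i))\<^sup>2 \<le> real (card I) * (\<Sum>i\<in>I. (norm (v i))\<^sup>2)"
proof -
  have "(norm (\<Sum>i\<in>I. v i))\<^sup>2 \<le> (\<Sum>i\<in>I. norm (v i))\<^sup>2"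
    by (intro power_mono norm_sum) simp
  also have "\<dots> \<le> (\<Sum>i\<in>I. (norm (v i))\<^sup>2) * real (card I)"
    using sum_squared_le_sum_of_squares by (metis mult.commute)
  finally show ?thesis by (simp add: mult.commute)
qed

section \<open>The averaged Hessian, the affine solution set and the residual\<close>

locale interpolated_quadratics =
  fixes n :: nat and \<gamma> :: real
    and A :: "nat \<Rightarrow> real^'d^'d" and b :: "nat \<Rightarrow> real^'d"
  assumes n: "n \<ge> 1" and \<gamma>: "\<gamma> > 0"
    and psd: "i \<in> {1..n} \<Longrightarrow> psd (A i)"
    and interpolation: "\<exists>z. \<forall>i\<in>{1..n}. A i *v z = b i"
begin

definition f where "f = (\<lambda>i. quadratic (A i) (b i))"

definition H where "H = moreau_hessian \<gamma> n A"

definition Z where "Z = solution_set n f"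

lemma mem_Z_iff: "z \<in> Z \<longleftrightarrow> (\<forall>i\<in>{1..n}. A i *v z = b i)"
  unfolding Z_def solution_set_def f_def
  using grad_eqI[OF gderiv_quadratic[OF psd]] by auto

lemma H_mult: "H *v e = (1 / real n) *\<^sub>R (\<Sum>i=1..n. yosida \<gamma> (A i) *v e)"
proof -
  have "(\<Sum>i\<in>I. yosida \<gamma> (A i)) *v e = (\<Sum>i\<in>I. yosida \<gamma> (A i) *v e)" for I
    by (induction I rule: infinite_finite_induct) (simp_all add: matrix_vector_mult_add_rdistrib)
  then show ?thesis
    by (simp add: H_def moreau_hessian_def yosida_def[symmetric] scaleR_matrix_vector_assoc[symmetric])
qed

lemma inner_H: "u \<bullet> (H *v v) = (1 / real n) * (\<Sum>i=1..n. u \<bullet> (yosida \<gamma> (A i) *v v))"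
  by (simp add: H_mult inner_sum_right)

lemma psd_H: "psd H"
proof -
  note Y = psd_yosida[OF psd \<gamma>]
  have "u \<bullet> (H *v v) = (H *v u) \<bullet> v" for u v
    unfolding inner_commute[of "H *v u"] inner_H
    using psd_inner[OF Y] by (auto intro!: sum.cong simp: inner_commute)
  then have "transpose H = H"
    by (metis dot_lmul_matrix inner_commute matrix_eq transpose_matrix_vector vector_eq_ldot)
  moreover have "0 \<le> v \<bullet> (H *v v)" for v
    unfolding inner_H by (intro mult_nonneg_nonneg sum_nonneg psd_nonneg[OF Y]) auto
  ultimately show ?thesis by (simp add: psd_def)
qed

text \<open>The form of \<open>H\<close> averages nonnegative forms, so it vanishes only if each of
  them does, and a Yosida approximation has the kernel of its matrix. Thus the kernel of
  \<open>H\<close> is the direction space of the affine set \<open>Z\<close>.\<close>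

lemma H_eq_0_iff: "H *v e = 0 \<longleftrightarrow> (\<forall>i\<in>{1..n}. A i *v e = 0)"
proof
  note Y = psd_yosida[OF psd \<gamma>]
  assume "H *v e = 0"
  then have "(\<Sum>i=1..n. e \<bullet> (yosida \<gamma> (A i) *v e)) = 0"
    using inner_H[of e e] n by simp
  then have "\<forall>i\<in>{1..n}. e \<bullet> (yosida \<gamma> (A i) *v e) = 0"
    using psd_nonneg[OF Y] by (subst (asm) sum_nonneg_eq_0_iff) auto
  then show "\<forall>i\<in>{1..n}. A i *v e = 0"
    using psd_kernel[OF Y] yosida_eq_0_iff[OF psd \<gamma>] by blast
next
  assume "\<forall>i\<in>{1..n}. A i *v e = 0"
  then have "(\<Sum>i=1..n. yosida \<gamma> (A i) *v e) = 0"
    using yosida_eq_0_iff[OF psd \<gamma>] by (intro sum.neutral) blast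
  then show "H *v e = 0" by (simp add: H_mult)
qed

lemma closed_Z: "closed Z" and convex_Z: "convex Z" and Z_ne: "Z \<noteq> {}"
proof -
  have Z: "Z = (\<Inter>i\<in>{1..n}. {z. A i *v z = b i})" by (auto simp: mem_Z_iff)
  show "closed Z" unfolding Z
    by (intro closed_INT ballI closed_Collect_eq continuous_intros
        matrix_vector_mult_linear_continuous_on)
  show "convex Z"
    by (auto simp: convex_def mem_Z_iff matrix_vector_right_distrib matrix_vector_mult_scaleR
        scaleR_left_distrib[symmetric])
  show "Z \<noteq> {}" using interpolation mem_Z_iff by blast
qed

abbreviation residual where "residual x \<equiv> x - closest_point Z x"

lemma closest_point_solution: "i \<in> {1..n} \<Longrightarrow> A i *v closest_point Z x = b i"
  using closest_point_in_set[OF closed_Z Z_ne] mem_Z_iff by blast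

lemma avg_grad_moreau_eq: "avg_grad_moreau \<gamma> n f x = H *v residual x"
  unfolding avg_grad_moreau_def f_def H_mult
  using grad_moreau_quadratic(1)[OF psd \<gamma> closest_point_solution] by simp

text \<open>If \<open>H\<close> annihilates the residual, then \<open>x\<close> satisfies the same
  linear equations as its projection. Hence the denominators of both stepsizes vanish exactly on
  \<open>Z\<close>.\<close>

lemma residual_eq_0_iff: "residual x = 0 \<longleftrightarrow> H *v residual x = 0"
proof
  assume "H *v residual x = 0"
  then have "\<forall>i\<in>{1..n}. A i *v residual x = 0" by (simp only: H_eq_0_iff)
  then have "\<forall>i\<in>{1..n}. A i *v x = b i"
    using closest_point_solution by (auto simp: matrix_vector_mult_diff_distrib)
  then have "x \<in> Z" by (simp add: mem_Z_iff)
  then show "residual x = 0" by (simp add: closest_point_self)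
qed simp

text \<open>Translations by kernel vectors of \<open>H\<close> preserve \<open>Z\<close>, so the
  residual is orthogonal to that kernel and the bound by the smallest nonzero eigenvalue
  applies.\<close>

lemma residual_Rayleigh:
  "mu_gamma_pos \<gamma> n A * (norm (residual x))\<^sup>2 \<le> residual x \<bullet> (H *v residual x)"
  unfolding mu_gamma_pos_def H_def[symmetric]
proof (rule psd_Rayleigh_ge_lambda_min_pos[OF psd_H])
  fix w assume "H *v w = 0"
  then show "residual x \<bullet> w = 0"
    by (intro closest_point_affine_orthogonal closed_Z convex_Z Z_ne)
      (simp add: mem_Z_iff H_eq_0_iff matrix_vector_right_distrib matrix_vector_mult_diff_distrib)
qed

section \<open>Effect of one step on the distance to the solution set\<close>

lemma step_eq:
  assumes "fedexprox \<gamma> n f \<alpha> x"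
  shows "x (Suc k) = x k - (\<alpha> k * \<gamma>) *\<^sub>R (H *v residual (x k))"
proof -
  have "(\<Sum>i=1..n. prox \<gamma> (f i) (x k)) =
      (\<Sum>i=1..n. x k - \<gamma> *\<^sub>R (yosida \<gamma> (A i) *v residual (x k)))"
    unfolding f_def using grad_moreau_quadratic(2)[OF psd \<gamma> closest_point_solution]
    by (intro sum.cong) auto
  also have "\<dots> = real n *\<^sub>R x k - (real n * \<gamma>) *\<^sub>R (H *v residual (x k))"
    using n by (simp add: sum_subtractf H_mult scaleR_sum_right[symmetric] sum_constant_scaleR
        del: sum_constant)
  finally have "(1 / real n) *\<^sub>R (\<Sum>i=1..n. prox \<gamma> (f i) (x k)) = x k - \<gamma> *\<^sub>R (H *v residual (x k))"
    using n by (simp add: scaleR_diff_right)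
  then show ?thesis using assms unfolding fedexprox_def by simp
qed

text \<open>The new distance to \<open>Z\<close> is at most the distance from the new iterate to the
  old projection; the square of the latter is expanded.\<close>

lemma residual_step:
  assumes "fedexprox \<gamma> n f \<alpha> x"
  shows "(norm (residual (x (Suc k))))\<^sup>2 \<le> (norm (residual (x k)))\<^sup>2
    - \<alpha> k * \<gamma> * (2 * (residual (x k) \<bullet> (H *v residual (x k)))
      - \<gamma> * (\<alpha> k * (norm (H *v residual (x k)))\<^sup>2))"
proof -
  let ?e = "residual (x k)"
  have "closest_point Z (x k) \<in> Z" using closed_Z Z_ne by (rule closest_point_in_set)
  then have "norm (residual (x (Suc k))) \<le> norm (x (Suc k) - closest_point Z (x k))"
    using closest_point_le[OF closed_Z] by (simp add: dist_norm)
  also have "x (Suc k) - closest_point Z (x k) = ?e - (\<alpha> k * \<gamma>) *\<^sub>R (H *v ?e)"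
    by (simp add: step_eq[OF assms])
  finally have "(norm (residual (x (Suc k))))\<^sup>2 \<le> (norm (?e - (\<alpha> k * \<gamma>) *\<^sub>R (H *v ?e)))\<^sup>2"
    by (simp add: power_mono)
  also have "\<dots> = (norm ?e)\<^sup>2 - 2 * (\<alpha> k * \<gamma>) * (?e \<bullet> (H *v ?e)) + (\<alpha> k * \<gamma>)\<^sup>2 * (norm (H *v ?e))\<^sup>2"
    unfolding power2_norm_eq_inner
    by (simp add: inner_diff_left inner_diff_right inner_commute power2_eq_square algebra_simps)
  finally show ?thesis by (simp add: algebra_simps power2_eq_square)
qed

text \<open>The part common to both strategies: \<open>r\<close> measures how much of the linear
  decrease survives the quadratic term, and the eigenvalue bound turns what survives into a
  contraction.\<close>

lemma contraction_step:
  assumes fed: "fedexprox \<gamma> n f \<alpha> x" and "0 \<le> r"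
    and active: "H *v residual (x k) \<noteq> 0 \<Longrightarrow> 0 \<le> \<alpha> k \<and>
      r * (residual (x k) \<bullet> (H *v residual (x k)))
      \<le> 2 * (residual (x k) \<bullet> (H *v residual (x k))) - \<gamma> * (\<alpha> k * (norm (H *v residual (x k)))\<^sup>2)"
  shows "(norm (residual (x (Suc k))))\<^sup>2
    \<le> (1 - \<alpha> k * \<gamma> * r * mu_gamma_pos \<gamma> n A) * (norm (residual (x k)))\<^sup>2"
proof (cases "H *v residual (x k) = 0")
  case True
  \<comment> \<open>Here \<open>\<alpha> k\<close> is an arbitrary real, but it multiplies a zero
    direction, and both sides of the claim are 0.\<close>
  then have "x (Suc k) = x k" by (simp add: step_eq[OF fed])
  moreover have "residual (x k) = 0" using True residual_eq_0_iff by blast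
  ultimately show ?thesis by simp
next
  case False
  let ?e = "residual (x k)"
  note a = active[OF False]
  have "r * (mu_gamma_pos \<gamma> n A * (norm ?e)\<^sup>2) \<le> r * (?e \<bullet> (H *v ?e))"
    using residual_Rayleigh \<open>0 \<le> r\<close> by (rule mult_left_mono)
  also have "\<dots> \<le> 2 * (?e \<bullet> (H *v ?e)) - \<gamma> * (\<alpha> k * (norm (H *v ?e))\<^sup>2)"
    using a by blast
  finally have "\<alpha> k * \<gamma> * (r * (mu_gamma_pos \<gamma> n A * (norm ?e)\<^sup>2))
    \<le> \<alpha> k * \<gamma> * (2 * (?e \<bullet> (H *v ?e)) - \<gamma> * (\<alpha> k * (norm (H *v ?e))\<^sup>2))"
    using a \<gamma> by (intro mult_left_mono) auto
  with residual_step[OF fed, of k] show ?thesis by (simp add: algebra_simps)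
qed

section \<open>The gradient diversity stepsize\<close>

lemma grads_stepsize:
  assumes "grads_stepsizes \<gamma> n f \<alpha> x" "H *v residual (x k) \<noteq> 0"
  shows "\<alpha> k * (norm (H *v residual (x k)))\<^sup>2
    = (1 / real n) * (\<Sum>i=1..n. (norm (yosida \<gamma> (A i) *v residual (x k)))\<^sup>2)"
proof -
  have "grad (moreau \<gamma> (f i)) (x k) = yosida \<gamma> (A i) *v residual (x k)" if "i \<in> {1..n}" for i
    unfolding f_def using grad_moreau_quadratic(1)[OF psd \<gamma> closest_point_solution] that by blast
  then show ?thesis
    using assms unfolding grads_stepsizes_def avg_grad_moreau_eq by simp
qed

text \<open>By convexity of the squared norm, the squared norm of the average gradient is at most
  the average of the squared norms, which is the numerator of the stepsize.\<close>

lemma grads_stepsize_ge_1: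
  assumes "grads_stepsizes \<gamma> n f \<alpha> x" "H *v residual (x k) \<noteq> 0"
  shows "1 \<le> \<alpha> k"
proof -
  let ?N = "(norm (H *v residual (x k)))\<^sup>2"
  have "?N = (norm (\<Sum>i=1..n. yosida \<gamma> (A i) *v residual (x k)))\<^sup>2 / (real n)\<^sup>2"
    by (simp add: H_mult power_divide)
  also have "\<dots> \<le> real n * (\<Sum>i=1..n. (norm (yosida \<gamma> (A i) *v residual (x k)))\<^sup>2) / (real n)\<^sup>2"
    using norm_sum_squared_le[of "\<lambda>i. yosida \<gamma> (A i) *v residual (x k)" "{1..n}"]
    by (intro divide_right_mono) auto
  also have "\<dots> = \<alpha> k * ?N"
    unfolding grads_stepsize[OF assms] using n by (simp add: power2_eq_square)
  finally show ?thesis using assms(2) by simp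
qed

lemma lambda_max_le_L_max: "i \<in> {1..n} \<Longrightarrow> lambda_max (A i) \<le> L_max n A"
  unfolding L_max_def by (rule Max_ge) auto

lemma L_max_nonneg: "0 \<le> L_max n A"
  using lambda_max_le_L_max[of 1] psd_Rayleigh_le_lambda_max(2)[OF psd[of 1]] n by simp

text \<open>The stepsize replaces the squared norm of the average gradient by the average of the
  squared norms. The required inequality is then the average over \<open>i\<close> of
  \<open>yosida_gap\<close>, with \<open>L_max n A\<close> as common bound.\<close>

lemma grads_step:
  assumes "fedexprox \<gamma> n f \<alpha> x" "grads_stepsizes \<gamma> n f \<alpha> x"
  shows "(norm (residual (x (Suc k))))\<^sup>2
    \<le> (1 - \<alpha> k * \<gamma> * ((2 + \<gamma> * L_max n A) / (1 + \<gamma> * L_max n A)) * mu_gamma_pos \<gamma> n A)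
      * (norm (residual (x k)))\<^sup>2"
proof (rule contraction_step[OF assms(1)])
  let ?r = "(2 + \<gamma> * L_max n A) / (1 + \<gamma> * L_max n A)" and ?e = "residual (x k)"
  show "0 \<le> ?r" using L_max_nonneg \<gamma> by simp
  assume act: "H *v ?e \<noteq> 0"
  have "?r * (?e \<bullet> (H *v ?e)) = (1 / real n) * (\<Sum>i=1..n. ?r * (?e \<bullet> (yosida \<gamma> (A i) *v ?e)))"
    unfolding inner_H sum_distrib_left by (intro sum.cong refl mult.left_commute)
  also have "\<dots> \<le> (1 / real n) * (\<Sum>i=1..n. 2 * (?e \<bullet> (yosida \<gamma> (A i) *v ?e))
      - \<gamma> * (norm (yosida \<gamma> (A i) *v ?e))\<^sup>2)"
    by (intro mult_left_mono sum_mono yosida_gap psd \<gamma> lambda_max_le_L_max) auto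
  also have "\<dots> = 2 * (?e \<bullet> (H *v ?e)) - \<gamma> * (\<alpha> k * (norm (H *v ?e))\<^sup>2)"
    unfolding grads_stepsize[OF assms(2) act] inner_H
    by (simp add: sum_subtractf sum_distrib_left[symmetric] right_diff_distrib diff_divide_distrib)
  finally show "0 \<le> \<alpha> k \<and> ?r * (?e \<bullet> (H *v ?e))
      \<le> 2 * (?e \<bullet> (H *v ?e)) - \<gamma> * (\<alpha> k * (norm (H *v ?e))\<^sup>2)"
    using grads_stepsize_ge_1[OF assms(2) act] by simp
qed

section \<open>The stochastic Polyak stepsize\<close>

lemma stops_stepsize:
  assumes "stops_stepsizes \<gamma> n f \<alpha> x" "H *v residual (x k) \<noteq> 0"
  shows "\<gamma> * (\<alpha> k * (norm (H *v residual (x k)))\<^sup>2) = 1/2 * (residual (x k) \<bullet> (H *v residual (x k)))"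
proof -
  \<comment> \<open>The projection minimises all the envelopes at once, so each gap is half a
    quadratic form of the same residual.\<close>
  have "(\<Sum>i=1..n. moreau \<gamma> (f i) (x k) - (INF y. moreau \<gamma> (f i) y))
      = (\<Sum>i=1..n. 1/2 * (residual (x k) \<bullet> (yosida \<gamma> (A i) *v residual (x k))))"
    unfolding f_def using moreau_gap_quadratic[OF psd \<gamma> closest_point_solution]
    by (intro sum.cong) auto
  also have "\<dots> = 1/2 * (real n * (residual (x k) \<bullet> (H *v residual (x k))))"
    unfolding inner_H sum_distrib_left using n by (intro sum.cong) auto
  finally have gap: "(1 / real n) * (\<Sum>i=1..n. moreau \<gamma> (f i) (x k) - (INF y. moreau \<gamma> (f i) y))
      = 1/2 * (residual (x k) \<bullet> (H *v residual (x k)))"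
    using n by simp
  have "\<alpha> k = 1/2 * (residual (x k) \<bullet> (H *v residual (x k)))
      / (\<gamma> * (norm (H *v residual (x k)))\<^sup>2)"
    using assms unfolding stops_stepsizes_def avg_grad_moreau_eq gap[symmetric] by blast
  then show ?thesis using assms(2) \<gamma> by simp
qed

text \<open>Cocoercivity of \<open>H\<close> with constant \<open>L_gamma \<gamma> n A\<close>
  bounds the denominator of the stepsize by a multiple of its numerator. Positivity of the constant
  gives the quotient its meaning and makes the stepsize positive.\<close>

lemma stops_stepsize_lower_bound:
  assumes "stops_stepsizes \<gamma> n f \<alpha> x" "H *v residual (x k) \<noteq> 0"
  shows "1 / (2 * \<gamma> * L_gamma \<gamma> n A) \<le> \<alpha> k" and "0 < L_gamma \<gamma> n A"
proof -
  let ?e = "residual (x k)" and ?L = "L_gamma \<gamma> n A"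
  define N where "N = (norm (H *v ?e))\<^sup>2"
  have N: "N > 0" using assms(2) by (simp add: N_def)
  have le: "N \<le> ?L * (?e \<bullet> (H *v ?e))"
    unfolding N_def L_gamma_def H_def[symmetric] by (rule psd_cocoercive[OF psd_H order_refl])
  with N psd_nonneg[OF psd_H, of ?e] show L: "0 < ?L"
    by (smt (verit) mult_nonpos_nonneg)
  have "?e \<bullet> (H *v ?e) = 2 * \<gamma> * (\<alpha> k * N)"
    using stops_stepsize[OF assms] unfolding N_def by simp
  with le have "N \<le> ?L * (2 * \<gamma> * (\<alpha> k * N))" by simp
  then have "1 * N \<le> (?L * 2 * \<gamma> * \<alpha> k) * N" by (simp add: algebra_simps)
  then have "1 \<le> ?L * 2 * \<gamma> * \<alpha> k" using N by simp
  then show "1 / (2 * \<gamma> * ?L) \<le> \<alpha> k"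
    using L \<gamma> by (simp add: field_simps)
qed

text \<open>The quadratic term equals exactly half of the form of \<open>H\<close> at the residual,
  which leaves \<open>r = 2 - 1/2\<close>.\<close>

lemma stops_step:
  assumes "fedexprox \<gamma> n f \<alpha> x" "stops_stepsizes \<gamma> n f \<alpha> x"
  shows "(norm (residual (x (Suc k))))\<^sup>2
    \<le> (1 - \<alpha> k * \<gamma> * (3/2) * mu_gamma_pos \<gamma> n A) * (norm (residual (x k)))\<^sup>2"
proof (rule contraction_step[OF assms(1)])
  let ?e = "residual (x k)"
  assume act: "H *v ?e \<noteq> 0"
  have "0 \<le> 1 / (2 * \<gamma> * L_gamma \<gamma> n A)"
    using stops_stepsize_lower_bound(2)[OF assms(2) act] \<gamma> by simp
  then have "0 \<le> \<alpha> k"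
    using stops_stepsize_lower_bound(1)[OF assms(2) act] by linarith
  then show "0 \<le> \<alpha> k \<and> 3/2 * (?e \<bullet> (H *v ?e))
      \<le> 2 * (?e \<bullet> (H *v ?e)) - \<gamma> * (\<alpha> k * (norm (H *v ?e))\<^sup>2)"
    unfolding stops_stepsize[OF assms(2) act] by simp
qed simp

end

theorem theorem6p1:
  fixes n :: nat and \<gamma> :: real
    and A :: "nat \<Rightarrow> real^'d^'d" and b :: "nat \<Rightarrow> real^'d"
    and f :: "nat \<Rightarrow> real^'d \<Rightarrow> real" and proj :: "real^'d \<Rightarrow> real^'d"
  assumes "n \<ge> 1" and "\<gamma> > 0"
    and "\<forall>i\<in>{1..n}. psd (A i)"
    and "f = (\<lambda>i. quadratic (A i) (b i))"
    and "\<exists>xs. \<forall>i\<in>{1..n}. grad (f i) xs = 0"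
    and "proj = closest_point (solution_set n f)"
  shows
    "(\<forall>\<alpha> x. fedexprox \<gamma> n f \<alpha> x \<and> grads_stepsizes \<gamma> n f \<alpha> x \<longrightarrow>
        (\<forall>k. avg_grad_moreau \<gamma> n f (x k) \<noteq> 0 \<longrightarrow> \<alpha> k \<ge> 1) \<and>
        (\<forall>K. let C = (MIN k\<in>{..<K}. \<alpha> k * \<gamma> * ((2 + \<gamma> * L_max n A) / (1 + \<gamma> * L_max n A))
                         * mu_gamma_pos \<gamma> n A)
             in (norm (x K - proj (x K)))\<^sup>2 \<le> (1 - C) ^ K * (norm (x 0 - proj (x 0)))\<^sup>2))
     \<and>
     (\<forall>\<alpha> x. fedexprox \<gamma> n f \<alpha> x \<and> stops_stepsizes \<gamma> n f \<alpha> x \<longrightarrow>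
        (\<forall>k. avg_grad_moreau \<gamma> n f (x k) \<noteq> 0 \<longrightarrow> \<alpha> k \<ge> 1 / (2 * \<gamma> * L_gamma \<gamma> n A)) \<and>
        (\<forall>K. let C = 3/2 * (MIN k\<in>{..<K}. \<alpha> k * \<gamma> * mu_gamma_pos \<gamma> n A)
             in (norm (x K - proj (x K)))\<^sup>2 \<le> (1 - C) ^ K * (norm (x 0 - proj (x 0)))\<^sup>2))"
proof -
  have grad_f: "grad (f i) z = A i *v z - b i" if "i \<in> {1..n}" for i z
    unfolding assms(4) using assms(3) that by (intro grad_eqI gderiv_quadratic) blast
  interpret Q: interpolated_quadratics n \<gamma> A b
    using assms(1-3,5) grad_f by unfold_locales auto
  have f: "f = Q.f" by (simp add: assms(4) Q.f_def)
  have proj: "proj = closest_point Q.Z" by (simp add: assms(6) Q.Z_def f)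
  show ?thesis unfolding f proj Let_def
  proof (intro conjI allI impI; elim conjE)
    fix \<alpha> x k
    assume "grads_stepsizes \<gamma> n Q.f \<alpha> x" "avg_grad_moreau \<gamma> n Q.f (x k) \<noteq> 0"
    then show "1 \<le> \<alpha> k"
      unfolding Q.avg_grad_moreau_eq by (rule Q.grads_stepsize_ge_1)
  next
    fix \<alpha> x k
    assume "stops_stepsizes \<gamma> n Q.f \<alpha> x" "avg_grad_moreau \<gamma> n Q.f (x k) \<noteq> 0"
    then show "1 / (2 * \<gamma> * L_gamma \<gamma> n A) \<le> \<alpha> k"
      unfolding Q.avg_grad_moreau_eq by (rule Q.stops_stepsize_lower_bound(1))
  next
    fix \<alpha> x and K :: nat
    assume "fedexprox \<gamma> n Q.f \<alpha> x" "grads_stepsizes \<gamma> n Q.f \<alpha> x"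
    note step = Q.grads_step[OF this]
    \<comment> \<open>For \<open>K = 0\<close> the minimum over the empty set is unspecified, but it
      enters only through a power with exponent 0.\<close>
    show "(norm (x K - closest_point Q.Z (x K)))\<^sup>2
      \<le> (1 - (MIN k\<in>{..<K}. \<alpha> k * \<gamma> * ((2 + \<gamma> * L_max n A) / (1 + \<gamma> * L_max n A))
            * mu_gamma_pos \<gamma> n A)) ^ K * (norm (x 0 - closest_point Q.Z (x 0)))\<^sup>2"
      by (rule geometric_contraction[where D = "\<lambda>k. (norm (x k - closest_point Q.Z (x k)))\<^sup>2", OF _ step])
        (auto intro!: Min_le)
  next
    fix \<alpha> x and K :: nat
    assume "fedexprox \<gamma> n Q.f \<alpha> x" "stops_stepsizes \<gamma> n Q.f \<alpha> x"
    note step = Q.stops_step[OF this]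
    have "3/2 * (MIN k\<in>{..<K}. \<alpha> k * \<gamma> * mu_gamma_pos \<gamma> n A)
        \<le> \<alpha> k * \<gamma> * (3/2) * mu_gamma_pos \<gamma> n A" if "k < K" for k
    proof -
      have "(MIN k\<in>{..<K}. \<alpha> k * \<gamma> * mu_gamma_pos \<gamma> n A) \<le> \<alpha> k * \<gamma> * mu_gamma_pos \<gamma> n A"
        using that by (intro Min_le) auto
      then show ?thesis by simp
    qed
    then show "(norm (x K - closest_point Q.Z (x K)))\<^sup>2
      \<le> (1 - 3/2 * (MIN k\<in>{..<K}. \<alpha> k * \<gamma> * mu_gamma_pos \<gamma> n A)) ^ K
        * (norm (x 0 - closest_point Q.Z (x 0)))\<^sup>2"
      by (intro geometric_contraction[where D = "\<lambda>k. (norm (x k - closest_point Q.Z (x k)))\<^sup>2", OF _ step])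
        auto
  qed
qed

end
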